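(* Let $V$ be a two-dimensional real vector space and let $\gamma\subset V$ be a closed curve which is the boundary of a convex body and is centered at the origin $o$ (i.e. $\gamma=-\gamma$). Then $\gamma$ is a Radon curve if and only if for every $p\in V\setminus\mathrm{conv}(\gamma)$ the following property holds. Let $r$ and $s$ be the two tangents (supporting lines) to $\mathrm{conv}(\gamma)$ passing through $p$. Let $x_1$ be the point where the line parallel to $r$ through $o$ intersects $s$, and let $x_0$ be the point where this line intersects $\gamma$ on the ray from $o$ through $x_1$. Let $y_1$ be the point where the line parallel to $s$ through $o$ intersects $r$, and let $y_0$ be the point where this line intersects $\gamma$ on the ray from $o$ through $y_1$. Then the line through $x_1$ and $y_1$ is parallel to the line through $x_0$ and $y_0$.
   Context: A convex body is a compact convex set with interior points. Parallel lines are allowed to coincide. Radon curves. A curve $\gamma\subset V$ is a Radon curve if it arises from the following construction. Take linearly independent $v,w\in V$ and the non-degenerate symplectic bilinear form $[\cdot,\cdot]$ on $V$ with $[v,w]=1$. Let $\gamma_1$ be a curve connecting $v$ and $w$, with $\gamma_1\subseteq\mathrm{conv}\{o,v,w,v+w\}$, such that the union of $\gamma_1$ with the segments from $o$ to $v$ and from $o$ to $w$ is the boundary of a convex body. Let $\gamma_2$ be the curve $$\gamma_2(\lambda)=\frac{(1-\lambda)w+\lambda(-v)}{\sup_{x\in\gamma_1}|[x,(1-\lambda)w+\lambda(-v)]|},\qquad \lambda\in[0,1].$$ Then $\gamma=\gamma_1\cup\gamma_2\cup(-\gamma_1)\cup(-\gamma_2)$. *)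

theory Defs
  imports "HOL-Analysis.Analysis"
begin

definition convex_body :: "'a::euclidean_space set \<Rightarrow> bool" where
  "convex_body K \<longleftrightarrow> compact K \<and> convex K \<and> interior K \<noteq> {}"

text \<open>Curves are identified with their traces.\<close>

definition closed_curve :: "'a::topological_space set \<Rightarrow> bool" where
  "closed_curve \<gamma> \<longleftrightarrow> (\<exists>g. path g \<and> pathfinish g = pathstart g \<and> path_image g = \<gamma>)"

definition curve_connecting :: "'a::topological_space \<Rightarrow> 'a \<Rightarrow> 'a set \<Rightarrow> bool" where
  "curve_connecting a b \<gamma> \<longleftrightarrow>
     (\<exists>g. arc g \<and> pathstart g = a \<and> pathfinish g = b \<and> path_image g = \<gamma>)"

definition symplectic_form :: "('a::real_vector \<Rightarrow> 'a \<Rightarrow> real) \<Rightarrow> bool" where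
  "symplectic_form \<omega> \<longleftrightarrow>
     bilinear \<omega> \<and> (\<forall>x. \<omega> x x = 0) \<and> (\<forall>x. (\<forall>y. \<omega> x y = 0) \<longrightarrow> x = 0)"

definition conjugate_arc ::
    "('a::real_vector \<Rightarrow> 'a \<Rightarrow> real) \<Rightarrow> 'a \<Rightarrow> 'a \<Rightarrow> 'a set \<Rightarrow> real \<Rightarrow> 'a" where
  "conjugate_arc \<omega> v w \<gamma>\<^sub>1 t =
     (let u = (1 - t) *\<^sub>R w + t *\<^sub>R (- v) in u /\<^sub>R (SUP x\<in>\<gamma>\<^sub>1. \<bar>\<omega> x u\<bar>))"

text \<open>The clause \<open>v \<noteq> w\<close> is needed because \<open>{v, w}\<close> collapses to a singleton if \<open>v = w\<close>.
  In dimension two, \<open>\<omega>\<close> is uniquely determined by \<open>\<omega> v w = 1\<close>.\<close>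

definition radon_curve :: "'a::euclidean_space set \<Rightarrow> bool" where
  "radon_curve \<gamma> \<longleftrightarrow>
     (\<exists>v w \<omega> \<gamma>\<^sub>1 \<gamma>\<^sub>2.
        v \<noteq> w \<and> independent {v, w} \<and>
        symplectic_form \<omega> \<and> \<omega> v w = 1 \<and>
        curve_connecting v w \<gamma>\<^sub>1 \<and>
        \<gamma>\<^sub>1 \<subseteq> convex hull {0, v, w, v + w} \<and>
        (\<exists>K. convex_body K \<and>
             \<gamma>\<^sub>1 \<union> closed_segment 0 v \<union> closed_segment 0 w = frontier K) \<and>
        \<gamma>\<^sub>2 = conjugate_arc \<omega> v w \<gamma>\<^sub>1 ` {0..1} \<and>
        \<gamma> = \<gamma>\<^sub>1 \<union> \<gamma>\<^sub>2 \<union> uminus ` \<gamma>\<^sub>1 \<union> uminus ` \<gamma>\<^sub>2)"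

text \<open>A supporting line is a line that meets \<open>C\<close> and has \<open>C\<close> on one side. The set \<open>L\<close> below
  is a hyperplane, hence a line exactly when the ambient space is two-dimensional.\<close>

definition supporting_line :: "'a::euclidean_space set \<Rightarrow> 'a set \<Rightarrow> bool" where
  "supporting_line C L \<longleftrightarrow>
     (\<exists>a b. a \<noteq> 0 \<and> L = {x. a \<bullet> x = b} \<and> C \<subseteq> {x. a \<bullet> x \<le> b}) \<and> L \<inter> C \<noteq> {}"

definition ray_through :: "'a::real_vector \<Rightarrow> 'a set" where
  "ray_through x = {t *\<^sub>R x |t. t \<ge> 0}"

end

theory Submission imports Defs begin

text \<open>
  Let \<open>K = conv \<gamma>\<close> and let \<open>\<parallel>\<cdot>\<parallel>\<close> be the norm with unit ball \<open>K\<close>. Fix a symplectic form \<open>\<omega>\<close>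
  and consider the antinorm \<open>A u = sup {\<bar>\<omega> x u\<bar> | x \<in> K}\<close>. Both properties in the theorem say that
  \<open>A\<close> is a constant multiple of \<open>\<parallel>\<cdot>\<parallel>\<close>, i.e. that \<open>A\<close> is constant on \<open>\<gamma>\<close>.

  In the tangent configuration \<open>p = x\<^sub>1 + y\<^sub>1\<close>, and the two lines support \<open>K\<close> exactly when
  \<open>A x\<^sub>1 = \<bar>\<omega> x\<^sub>1 y\<^sub>1\<bar> = A y\<^sub>1\<close>, while the final parallelism says \<open>\<parallel>x\<^sub>1\<parallel> = \<parallel>y\<^sub>1\<parallel>\<close>. So the tangent
  property equates \<open>A / \<parallel>\<cdot>\<parallel>\<close> in any two directions whose circumscribed parallelogram has a corner
  \<open>x\<^sub>1 \<plusminus> y\<^sub>1\<close> outside \<open>K\<close>. If all corners lie in \<open>K\<close>, then so do the midpoints \<open>x\<^sub>1\<close> and \<open>y\<^sub>1\<close> of the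
  sides, whence \<open>\<parallel>x\<^sub>1\<parallel> = 1 = \<parallel>y\<^sub>1\<parallel>\<close> anyway.

  A Radon curve is by construction the unit circle of \<open>A\<close> in the second quadrant, and by duality
  in the first. Conversely, if \<open>A\<close> is constant on \<open>\<gamma>\<close>, then a pair \<open>v, w \<in> K\<close> maximizing \<open>\<omega>\<close>
  spans the required quadrants.
\<close>

section \<open>Symplectic planes\<close>

text \<open>The determinant of the coordinates is a witness. The tangent property mentions no form,
  so a proof starting from it has to supply one.\<close>

lemma exists_symplectic_form:
  assumes "DIM('a::euclidean_space) = 2"
  shows "\<exists>\<omega> :: 'a \<Rightarrow> 'a \<Rightarrow> real. symplectic_form \<omega>"
proof -
  obtain i j :: 'a where B: "Basis = {i, j}" "i \<noteq> j"
    using assms unfolding card_2_iff by blast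
  have i: "i \<in> Basis" and j: "j \<in> Basis" unfolding B(1) by blast+
  have ij: "i \<bullet> j = 0" "j \<bullet> i = 0" "i \<bullet> i = 1" "j \<bullet> j = 1"
    using inner_not_same_Basis[OF i j B(2)] inner_not_same_Basis[OF j i not_sym[OF B(2)]]
      inner_same_Basis[OF i] inner_same_Basis[OF j] by blast+
  define \<omega> :: "'a \<Rightarrow> 'a \<Rightarrow> real" where "\<omega> x y = (x \<bullet> i) * (y \<bullet> j) - (x \<bullet> j) * (y \<bullet> i)" for x y
  have "x = 0" if "\<And>y. \<omega> x y = 0" for x
  proof -
    have "x \<bullet> i = 0" "x \<bullet> j = 0"
      using that[of j] that[of i] unfolding \<omega>_def ij by simp_all
    then have b: "x \<bullet> b = 0" if "b \<in> Basis" for b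
      using that unfolding B(1) by blast
    show ?thesis
      by (rule euclidean_eqI) (simp add: b)
  qed
  moreover have "bilinear \<omega>"
    unfolding bilinear_def
    by (intro conjI allI linearI) (simp_all add: \<omega>_def inner_add_left algebra_simps)
  moreover have "\<omega> x x = 0" for x
    by (simp add: \<omega>_def)
  ultimately have "symplectic_form \<omega>"
    unfolding symplectic_form_def by blast
  then show ?thesis by (rule exI[of symplectic_form \<omega>])
qed

locale symplectic_plane =
  fixes \<omega> :: "'a::euclidean_space \<Rightarrow> 'a \<Rightarrow> real"
  assumes dim2: "DIM('a) = 2" and symplectic: "symplectic_form \<omega>"
begin

lemma bilinear: "bilinear \<omega>"
  using symplectic by (simp add: symplectic_form_def)

lemmas bilinear_rules [simp] =
  bilinear_ladd[OF bilinear] bilinear_radd[OF bilinear]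
  bilinear_lsub[OF bilinear] bilinear_rsub[OF bilinear]
  bilinear_lneg[OF bilinear] bilinear_rneg[OF bilinear]
  bilinear_lmul[OF bilinear] bilinear_rmul[OF bilinear]
  bilinear_lzero[OF bilinear] bilinear_rzero[OF bilinear]

lemma self_zero [simp]: "\<omega> x x = 0"
  using symplectic by (simp add: symplectic_form_def)

lemma swap: "\<omega> y x = - \<omega> x y"
proof -
  have "\<omega> (x + y) (x + y) = 0" by (rule self_zero)
  then have "\<omega> x y + \<omega> y x = 0"
    unfolding bilinear_ladd[OF bilinear] bilinear_radd[OF bilinear] by simp
  then show ?thesis by simp
qed

lemma nondegenerate: "x \<noteq> 0 \<Longrightarrow> \<exists>y. \<omega> x y \<noteq> 0"
  using symplectic by (auto simp: symplectic_form_def)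

lemma independent_pair:
  assumes "\<omega> a b \<noteq> 0"
  shows "independent {a, b}" "a \<noteq> b"
proof -
  show ab: "a \<noteq> b" using assms by auto
  have "b \<noteq> 0" "a \<notin> span {b}"
    using assms by (auto simp: span_singleton)
  then show "independent {a, b}"
    using ab by (simp add: independent_insert)
qed

text \<open>Cramer's rule: two independent vectors span the plane, and pairing with each of them
  reads off the coefficient of the other.\<close>

lemma decomposition:
  assumes "\<omega> a b \<noteq> 0"
  shows "c = (\<omega> c b / \<omega> a b) *\<^sub>R a + (\<omega> a c / \<omega> a b) *\<^sub>R b"
proof -
  have "UNIV \<subseteq> span {a, b}"
    using independent_pair[OF assms] dim2
    by (intro card_ge_dim_independent) (auto simp: dim_UNIV)
  then have "c \<in> span {a, b}" by auto
  then obtain k l where c: "c = k *\<^sub>R a + l *\<^sub>R b"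
    by (auto simp: span_insert span_singleton algebra_simps)
  then show ?thesis using assms by simp
qed

lemma linear_form: "linear (\<lambda>x. \<omega> x y)" "linear (\<lambda>y. \<omega> x y)"
  using bilinear by (auto simp: bilinear_def)

text \<open>Riesz representation, needed because supporting lines and half-planes are expressed
  through the inner product.\<close>

lemma form_as_inner: "\<exists>a. \<forall>x. \<omega> x y = a \<bullet> x"
proof -
  have "\<omega> x y = adjoint (\<lambda>x. \<omega> x y) 1 \<bullet> x" for x
    using adjoint_works[OF linear_form(1), of x y 1] by (simp add: inner_commute)
  then show ?thesis by blast
qed

lemma continuous_on_form [continuous_intros]:
  assumes "continuous_on S f" "continuous_on S g"
  shows "continuous_on S (\<lambda>x. \<omega> (f x) (g x))"
  using bounded_bilinear.continuous_on[OF _ assms] bilinear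
  by (metis bilinear_conv_bounded_bilinear)

lemma unit_coords:
  "\<omega> v w = 1 \<Longrightarrow> z = \<omega> z w *\<^sub>R v + \<omega> v z *\<^sub>R w"
  using decomposition[of v w z] by simp

lemma form_coords:
  assumes vw: "\<omega> v w = 1"
  shows "\<omega> x y = \<omega> x w * \<omega> v y - \<omega> v x * \<omega> y w"
proof -
  have "\<omega> x y = \<omega> (\<omega> x w *\<^sub>R v + \<omega> v x *\<^sub>R w) y" using unit_coords[OF vw, of x] by simp
  then show ?thesis by (simp add: swap[of y w])
qed

end

section \<open>The antinorm of a symmetric convex body\<close>

locale symmetric_body = symplectic_plane \<omega> for \<omega> :: "'a::euclidean_space \<Rightarrow> 'a \<Rightarrow> real" +
  fixes K :: "'a set"
  assumes body: "convex_body K" and uminus_mem: "x \<in> K \<Longrightarrow> - x \<in> K"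
begin

lemma compact: "compact K" and convex: "convex K"
  using body by (auto simp: convex_body_def)

lemma frontier_eq: "frontier K = K - interior K"
  using compact by (simp add: frontier_def compact_imp_closed)

lemma frontier_mem: "x \<in> frontier K \<Longrightarrow> x \<in> K"
  by (simp add: frontier_eq)

text \<open>The origin is the midpoint of an interior point \<open>x\<close> and of
  \<open>- x\<close>, which lies in \<open>K\<close>.\<close>

lemma zero_interior: "0 \<in> interior K"
proof -
  obtain x e where e: "e > 0" "ball x e \<subseteq> K"
    using body by (auto simp: convex_body_def mem_interior)
  then have "x \<in> interior K" by (auto simp: mem_interior)
  then have "- x \<in> K" using interior_subset uminus_mem by blast
  have "- x - (1/2) *\<^sub>R (- x - x) \<in> interior K"
    using mem_interior_convex_shrink[OF convex \<open>x \<in> interior K\<close> \<open>- x \<in> K\<close>, of "1/2"] by simp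
  moreover have "- x - (1/2) *\<^sub>R (- x - x) = 0"
    by (simp add: algebra_simps flip: scaleR_add_left)
  ultimately show ?thesis by simp
qed

lemma zero_mem: "0 \<in> K"
  using zero_interior interior_subset by blast

lemma shrink_interior: "x \<in> K \<Longrightarrow> 0 \<le> t \<Longrightarrow> t < 1 \<Longrightarrow> t *\<^sub>R x \<in> interior K"
  using mem_interior_convex_shrink[OF convex zero_interior, of x "1 - t"]
  by (simp add: algebra_simps)

text \<open>By \<open>shrink_interior\<close>, a frontier point is never a proper shrinking of a
  point of \<open>K\<close>. Together with \<open>ray_frontier\<close> this stands in for the norm
  with unit ball \<open>K\<close>.\<close>

lemma frontier_scale_le:
  assumes "x \<in> frontier K" "t *\<^sub>R x \<in> K"
  shows "t \<le> 1"
proof (rule ccontr)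
  assume "\<not> t \<le> 1"
  then have "(1 / t) *\<^sub>R (t *\<^sub>R x) \<in> interior K"
    by (intro shrink_interior assms) auto
  then show False using assms \<open>\<not> t \<le> 1\<close> by (simp add: frontier_eq)
qed

lemma frontier_nonzero: "x \<in> frontier K \<Longrightarrow> x \<noteq> 0"
  using zero_interior by (auto simp: frontier_eq)

lemma ray_frontier:
  assumes "x \<noteq> 0"
  obtains t where "t > 0" "t *\<^sub>R x \<in> frontier K"
  using ray_to_frontier[OF compact_imp_bounded[OF compact] zero_interior assms] by auto

text \<open>The ray through \<open>- x\<close> meets the frontier at some factor \<open>t\<close>;
  \<open>frontier_scale_le\<close>, used at \<open>x\<close> and at that meeting point, forces
  \<open>t = 1\<close>.\<close>

lemma frontier_image_uminus: "uminus ` frontier K = frontier K"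
proof -
  have "- x \<in> frontier K" if x: "x \<in> frontier K" for x
  proof -
    obtain t where t: "t > 0" "t *\<^sub>R (- x) \<in> frontier K"
      using ray_frontier[of "- x"] frontier_nonzero[OF x] by auto
    have "t \<le> 1" using frontier_scale_le[OF x, of t] uminus_mem[OF frontier_mem[OF t(2)]] by simp
    moreover have "1 / t \<le> 1" using t uminus_mem[OF frontier_mem[OF x]]
      by (intro frontier_scale_le[OF t(2)]) simp
    ultimately have "t = 1" using t by simp
    then show ?thesis using t by simp
  qed
  then show ?thesis
    by (auto simp: image_iff) (metis minus_minus)
qed

lemma convex_hull_frontier: "convex hull (frontier K) = K"
  using Krein_Milman_frontier[OF convex compact] by simp

text \<open>The support function of \<open>K\<close>, transported from the dual plane to the plane
  by \<open>\<omega>\<close>; it measures how far \<open>K\<close> extends transversally to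
  \<open>u\<close>.\<close>

definition antinorm :: "'a \<Rightarrow> real" where
  "antinorm u = (SUP x\<in>K. \<bar>\<omega> x u\<bar>)"

lemma antinorm_bdd: "bdd_above ((\<lambda>x. \<bar>\<omega> x u\<bar>) ` K)"
  by (intro bounded_imp_bdd_above compact_imp_bounded compact_continuous_image compact
      continuous_intros)

lemma antinorm_upper: "x \<in> K \<Longrightarrow> \<bar>\<omega> x u\<bar> \<le> antinorm u"
  unfolding antinorm_def by (rule cSUP_upper[OF _ antinorm_bdd])

text \<open>By symmetry of \<open>K\<close>, a maximizer of the signed form also maximizes its
  absolute value.\<close>

lemma antinorm_attained: obtains x where "x \<in> K" "\<omega> x u = antinorm u"
proof -
  have "\<exists>x\<in>K. \<forall>y\<in>K. \<omega> y u \<le> \<omega> x u"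
    using zero_mem by (intro continuous_attains_sup compact continuous_intros) auto
  then obtain x where x: "x \<in> K" "\<And>y. y \<in> K \<Longrightarrow> \<omega> y u \<le> \<omega> x u" by blast
  have "\<bar>\<omega> y u\<bar> \<le> \<omega> x u" if "y \<in> K" for y
    using x(2)[OF that] x(2)[OF uminus_mem[OF that]] by simp
  then have "antinorm u \<le> \<omega> x u"
    unfolding antinorm_def using x(1) by (intro cSUP_least) auto
  with antinorm_upper[OF x(1), of u] have "\<omega> x u = antinorm u" by linarith
  with x(1) show ?thesis using that by blast
qed

lemma antinorm_least: "(\<And>x. x \<in> K \<Longrightarrow> \<bar>\<omega> x u\<bar> \<le> c) \<Longrightarrow> antinorm u \<le> c"
  by (metis antinorm_attained abs_le_D1)

lemma antinorm_scale: "antinorm (t *\<^sub>R u) = \<bar>t\<bar> * antinorm u"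
proof (rule antisym)
  show "antinorm (t *\<^sub>R u) \<le> \<bar>t\<bar> * antinorm u"
    by (intro antinorm_least) (simp add: abs_mult mult_left_mono antinorm_upper)
  obtain x where x: "x \<in> K" "\<omega> x u = antinorm u" by (rule antinorm_attained)
  then show "\<bar>t\<bar> * antinorm u \<le> antinorm (t *\<^sub>R u)"
    using antinorm_upper[OF x(1), of "t *\<^sub>R u"] antinorm_upper[OF x(1), of u]
    by (simp add: abs_mult)
qed

lemma antinorm_uminus: "antinorm (- u) = antinorm u"
  using antinorm_scale[of "-1" u] by simp

lemma antinorm_pos: "u \<noteq> 0 \<Longrightarrow> antinorm u > 0"
proof -
  assume "u \<noteq> 0"
  then obtain y where y: "\<omega> u y \<noteq> 0" using nondegenerate by blast
  then have "y \<noteq> 0" by auto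
  then obtain t where t: "t > 0" "t *\<^sub>R y \<in> frontier K" by (rule ray_frontier)
  have "0 < \<bar>\<omega> (t *\<^sub>R y) u\<bar>" using y t swap[of u y] by simp
  also have "\<dots> \<le> antinorm u" by (intro antinorm_upper frontier_mem t)
  finally show ?thesis .
qed

text \<open>A supremum of absolute values of linear functions is convex, and a finite convex
  function on the whole plane is continuous. This makes the radial parametrization in
  \<open>quarter_connecting\<close> a path.\<close>

lemma antinorm_continuous: "continuous_on UNIV antinorm"
proof (rule convex_on_continuous)
  show "convex_on UNIV antinorm"
  proof (rule convex_onI)
    fix t :: real and x y :: 'a
    assume t: "0 < t" "t < 1"
    show "antinorm ((1 - t) *\<^sub>R x + t *\<^sub>R y) \<le> (1 - t) * antinorm x + t * antinorm y"
    proof (rule antinorm_least)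
      fix z assume z: "z \<in> K"
      have "\<bar>\<omega> z ((1 - t) *\<^sub>R x + t *\<^sub>R y)\<bar> \<le> \<bar>(1 - t) * \<omega> z x\<bar> + \<bar>t * \<omega> z y\<bar>" by simp
      also have "\<dots> = (1 - t) * \<bar>\<omega> z x\<bar> + t * \<bar>\<omega> z y\<bar>" using t by (simp add: abs_mult)
      also have "\<dots> \<le> (1 - t) * antinorm x + t * antinorm y"
        using t z by (intro add_mono mult_left_mono antinorm_upper) auto
      finally show "\<bar>\<omega> z ((1 - t) *\<^sub>R x + t *\<^sub>R y)\<bar> \<le> (1 - t) * antinorm x + t * antinorm y" .
    qed
  qed simp
qed simp

section \<open>The tangent property\<close>

text \<open>The right-hand side of the theorem, with \<open>K\<close> for the hull and
  \<open>frontier K\<close> for the curve. It depends on \<open>K\<close> but not on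
  \<open>\<omega>\<close>, so interpretations with different forms share one predicate.\<close>

definition tangent_property :: bool where
  "tangent_property \<longleftrightarrow> (\<forall>p. p \<notin> K \<longrightarrow>
      (\<forall>r s r\<^sub>o s\<^sub>o x\<^sub>1 x\<^sub>0 y\<^sub>1 y\<^sub>0.
        r \<noteq> s \<and>
        supporting_line K r \<and> p \<in> r \<and>
        supporting_line K s \<and> p \<in> s \<and>
        affine_parallel r r\<^sub>o \<and> 0 \<in> r\<^sub>o \<and>
        x\<^sub>1 \<in> r\<^sub>o \<inter> s \<and> x\<^sub>0 \<in> r\<^sub>o \<inter> frontier K \<inter> ray_through x\<^sub>1 \<and>
        affine_parallel s s\<^sub>o \<and> 0 \<in> s\<^sub>o \<and>
        y\<^sub>1 \<in> s\<^sub>o \<inter> r \<and> y\<^sub>0 \<in> s\<^sub>o \<inter> frontier K \<inter> ray_through y\<^sub>1 \<longrightarrow>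
        affine_parallel (affine hull {x\<^sub>1, y\<^sub>1}) (affine hull {x\<^sub>0, y\<^sub>0})))"

text \<open>The level \<open>b\<close> is positive because \<open>a\<close> is positive at the
  frontier point on its own ray.\<close>

lemma supporting_lineE:
  assumes "supporting_line K r"
  obtains a b where "b > 0" "r = {x. a \<bullet> x = b}" "\<forall>x\<in>K. a \<bullet> x \<le> b"
    "\<exists>x\<in>K. a \<bullet> x = b"
proof -
  from assms obtain a b where ab: "a \<noteq> 0" "r = {x. a \<bullet> x = b}" "K \<subseteq> {x. a \<bullet> x \<le> b}"
    "r \<inter> K \<noteq> {}" by (auto simp: supporting_line_def)
  obtain t where t: "t > 0" "t *\<^sub>R a \<in> frontier K" using ab(1) by (rule ray_frontier)
  have "0 < a \<bullet> (t *\<^sub>R a)" using t ab(1) by simp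
  also have "\<dots> \<le> b" using ab(3) frontier_mem[OF t(2)] by blast
  finally show ?thesis using that[of b a] ab(2-4) by auto
qed

lemma supporting_line_nonzero:
  assumes "supporting_line K r" "x \<in> r"
  shows "x \<noteq> 0"
proof -
  obtain a b where "b > 0" "r = {x. a \<bullet> x = b}"
    using assms(1) by (rule supporting_lineE)
  then show ?thesis using assms(2) by auto
qed

text \<open>The functional defining \<open>r\<close> vanishes at \<open>x\<close>, hence is a
  multiple of \<open>\<omega> x\<close>. That its level line through \<open>y\<close> supports the
  symmetric set \<open>K\<close> says that the largest absolute value of \<open>\<omega> x\<close>
  on \<open>K\<close> is the one at \<open>y\<close>.\<close>

lemma antinorm_of_supporting_line:
  assumes "supporting_line K r" "affine_parallel r r\<^sub>o" "0 \<in> r\<^sub>o" "x \<in> r\<^sub>o" "y \<in> r" "x \<noteq> 0"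
  shows "antinorm x = \<bar>\<omega> x y\<bar>" "\<omega> x y \<noteq> 0"
proof -
  obtain a b where ab: "b > 0" "r = {x. a \<bullet> x = b}" "\<forall>x\<in>K. a \<bullet> x \<le> b"
    "\<exists>x\<in>K. a \<bullet> x = b" using assms(1) by (rule supporting_lineE)
  obtain c where c: "r\<^sub>o = (\<lambda>x. c + x) ` r" using assms(2) unfolding affine_parallel_def by blast
  have ro: "a \<bullet> z = a \<bullet> c + b" if "z \<in> r\<^sub>o" for z
    using that unfolding c ab(2) by (auto simp: inner_add_right)
  \<comment> \<open>\<open>a\<close> is constant on \<open>r\<^sub>o\<close>, which contains both
    \<open>0\<close> and \<open>x\<close>.\<close>
  have ax: "a \<bullet> x = 0" using ro[OF assms(3)] ro[OF assms(4)] by simp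
  have ay: "a \<bullet> y = b" using assms(5) ab(2) by simp
  show nz: "\<omega> x y \<noteq> 0"
  proof
    assume 0: "\<omega> x y = 0"
    obtain u where u: "\<omega> x u \<noteq> 0" using assms(6) nondegenerate by blast
    have "a \<bullet> y = a \<bullet> ((\<omega> y u / \<omega> x u) *\<^sub>R x + (\<omega> x y / \<omega> x u) *\<^sub>R u)"
      using decomposition[OF u, of y] by (rule arg_cong)
    then show False using ay ab(1) ax 0 by (simp add: inner_add_right)
  qed
  have az: "a \<bullet> z = (\<omega> x z / \<omega> x y) * b" for z
  proof -
    have "a \<bullet> z = a \<bullet> ((\<omega> z y / \<omega> x y) *\<^sub>R x + (\<omega> x z / \<omega> x y) *\<^sub>R y)"
      using decomposition[OF nz, of z] by (rule arg_cong)
    then show ?thesis by (simp add: inner_add_right ax ay)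
  qed
  have le: "\<omega> x z / \<omega> x y \<le> 1" if "z \<in> K" for z
  proof -
    have "(\<omega> x z / \<omega> x y) * b \<le> 1 * b"
      using ab(3)[rule_format, OF that] unfolding az by simp
    then show ?thesis using ab(1) by (rule mult_right_le_imp_le)
  qed
  show "antinorm x = \<bar>\<omega> x y\<bar>"
  proof (rule antisym)
    show "antinorm x \<le> \<bar>\<omega> x y\<bar>"
    proof (rule antinorm_least)
      fix z assume z: "z \<in> K"
      have "\<bar>\<omega> x z / \<omega> x y\<bar> \<le> 1" using le[OF z] le[OF uminus_mem[OF z]] by (simp add: abs_le_iff)
      then show "\<bar>\<omega> z x\<bar> \<le> \<bar>\<omega> x y\<bar>" using nz swap[of x z] by (simp add: divide_le_eq)
    qed
    obtain z where z: "z \<in> K" "a \<bullet> z = b" using ab(4) by blast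
    then have "(\<omega> x z / \<omega> x y) * b = 1 * b" unfolding az by (simp only: mult_1)
    then have "\<omega> x z / \<omega> x y = 1" using ab(1) unfolding mult_cancel_right by auto
    then have "\<omega> x z = \<omega> x y" using nz by simp
    then show "\<bar>\<omega> x y\<bar> \<le> antinorm x" using antinorm_upper[OF z(1), of x] swap[of x z] by simp
  qed
qed

text \<open>A converse: \<open>\<omega> x\<close>, scaled to equal 1 at \<open>y\<close>, is at most
  1 on \<open>K\<close> and attains 1 there.\<close>

lemma supporting_line_form:
  assumes "\<omega> x y \<noteq> 0" "antinorm x = \<bar>\<omega> x y\<bar>"
  shows "supporting_line K {z. \<omega> x z = \<omega> x y}"
proof -
  define f where "f z = \<omega> x z / \<omega> x y" for z
  obtain a where a: "\<And>z. \<omega> z x = a \<bullet> z" using form_as_inner by blast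
  define a' where "a' = (- 1 / \<omega> x y) *\<^sub>R a"
  have fa: "f z = a' \<bullet> z" for z
    using swap[of x z] a[of z] by (simp add: f_def a'_def)
  have set: "{z. \<omega> x z = \<omega> x y} = {z. a' \<bullet> z = 1}"
    using assms(1) by (auto simp: fa[symmetric] f_def)
  have "a' \<noteq> 0"
  proof
    assume "a' = 0"
    then have "f y = 0" using fa[of y] by simp
    then show False using assms(1) by (simp add: f_def)
  qed
  have "\<bar>f z\<bar> \<le> 1" if "z \<in> K" for z
    using antinorm_upper[OF that, of x] swap[of x z] assms by (simp add: f_def divide_le_eq)
  then have "K \<subseteq> {z. a' \<bullet> z \<le> 1}" using fa by (auto simp: abs_le_iff)
  obtain z where z: "z \<in> K" "\<omega> z x = antinorm x" by (rule antinorm_attained)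
  then have "\<bar>f z\<bar> = 1" using assms swap[of x z] by (simp add: f_def)
  moreover have "f (- z) = - f z" by (simp add: f_def)
  \<comment> \<open>The maximizer may touch the opposite parallel line; its mirror image is then the
    point of contact.\<close>
  ultimately have "f z = 1 \<or> f (- z) = 1" by linarith
  then have "{z. a' \<bullet> z = 1} \<inter> K \<noteq> {}"
    using z(1) uminus_mem[OF z(1)] unfolding fa by blast
  with \<open>K \<subseteq> _\<close> show ?thesis unfolding supporting_line_def set using \<open>a' \<noteq> 0\<close> by blast
qed

lemma affine_parallel_form:
  "affine_parallel {z. \<omega> x z = \<omega> x y} {z. \<omega> x z = 0}"
  unfolding affine_parallel_def
proof (rule exI)
  show "{z. \<omega> x z = 0} = (\<lambda>z. - y + z) ` {z. \<omega> x z = \<omega> x y}"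
  proof (intro equalityI subsetI)
    fix z assume "z \<in> {z. \<omega> x z = 0}"
    then show "z \<in> (\<lambda>z. - y + z) ` {z. \<omega> x z = \<omega> x y}"
      by (intro image_eqI[where x = "y + z"]) auto
  qed auto
qed

text \<open>Each tangent computes one antinorm, and both values are the absolute value of
  \<open>\<omega> x\<^sub>1 y\<^sub>1\<close>. Constancy on the frontier then makes the factors from
  \<open>x\<^sub>1\<close> to \<open>x\<^sub>0\<close> and from \<open>y\<^sub>1\<close> to
  \<open>y\<^sub>0\<close> equal.\<close>

lemma tangent_property_if_constant:
  assumes const: "\<And>d e. d \<in> frontier K \<Longrightarrow> e \<in> frontier K \<Longrightarrow> antinorm d = antinorm e"
  shows tangent_property
  unfolding tangent_property_def
proof (intro allI impI, elim conjE)
  fix p r s r\<^sub>o s\<^sub>o x\<^sub>1 x\<^sub>0 y\<^sub>1 y\<^sub>0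
  assume r: "supporting_line K r" and s: "supporting_line K s"
    and ro: "affine_parallel r r\<^sub>o" "0 \<in> r\<^sub>o" and so: "affine_parallel s s\<^sub>o" "0 \<in> s\<^sub>o"
    and x1: "x\<^sub>1 \<in> r\<^sub>o \<inter> s" and y1: "y\<^sub>1 \<in> s\<^sub>o \<inter> r"
    and x0: "x\<^sub>0 \<in> r\<^sub>o \<inter> frontier K \<inter> ray_through x\<^sub>1"
    and y0: "y\<^sub>0 \<in> s\<^sub>o \<inter> frontier K \<inter> ray_through y\<^sub>1"
  have nz: "x\<^sub>1 \<noteq> 0" "y\<^sub>1 \<noteq> 0" using supporting_line_nonzero r s x1 y1 by blast+
  have A: "antinorm x\<^sub>1 = antinorm y\<^sub>1"
    using antinorm_of_supporting_line(1)[OF r ro, of x\<^sub>1 y\<^sub>1]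
      antinorm_of_supporting_line(1)[OF s so, of y\<^sub>1 x\<^sub>1] x1 y1 nz swap[of x\<^sub>1 y\<^sub>1] by simp
  obtain k l where k: "k \<ge> 0" "x\<^sub>0 = k *\<^sub>R x\<^sub>1" and l: "l \<ge> 0" "y\<^sub>0 = l *\<^sub>R y\<^sub>1"
    using x0 y0 by (auto simp: ray_through_def)
  have k0: "k > 0" using k frontier_nonzero[of x\<^sub>0] x0 by (cases "k = 0") auto
  have "antinorm x\<^sub>0 = antinorm y\<^sub>0" using const x0 y0 by blast
  then have "k = l" using k l A antinorm_pos[OF nz(1)] antinorm_pos[OF nz(2)]
    by (simp add: antinorm_scale)
  \<comment> \<open>The two lines are related by a dilation with factor \<open>k\<close>. To exhibit
    it as a translation, the weight \<open>v\<close> on \<open>y\<^sub>0\<close> becomes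
    \<open>v * k\<close> on \<open>y\<^sub>1\<close>.\<close>
  have "affine hull {x\<^sub>0, y\<^sub>0} = (\<lambda>z. (x\<^sub>0 - x\<^sub>1) + z) ` (affine hull {x\<^sub>1, y\<^sub>1})"
  proof (intro equalityI subsetI)
    fix z assume "z \<in> affine hull {x\<^sub>0, y\<^sub>0}"
    then obtain u v where z: "z = u *\<^sub>R x\<^sub>0 + v *\<^sub>R y\<^sub>0" "u + v = 1" by (auto simp: affine_hull_2)
    then have u: "u = 1 - v" by simp
    have "z = (x\<^sub>0 - x\<^sub>1) + ((1 - v * k) *\<^sub>R x\<^sub>1 + (v * k) *\<^sub>R y\<^sub>1)"
      using z k l \<open>k = l\<close> u by (simp add: algebra_simps)
    moreover have "(1 - v * k) *\<^sub>R x\<^sub>1 + (v * k) *\<^sub>R y\<^sub>1 \<in> affine hull {x\<^sub>1, y\<^sub>1}"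
      unfolding affine_hull_2 by (intro CollectI exI conjI) (rule refl, simp)
    ultimately show "z \<in> (\<lambda>z. (x\<^sub>0 - x\<^sub>1) + z) ` (affine hull {x\<^sub>1, y\<^sub>1})" by blast
  next
    fix z assume "z \<in> (\<lambda>z. (x\<^sub>0 - x\<^sub>1) + z) ` (affine hull {x\<^sub>1, y\<^sub>1})"
    then obtain u v where z: "z = (x\<^sub>0 - x\<^sub>1) + (u *\<^sub>R x\<^sub>1 + v *\<^sub>R y\<^sub>1)" "u + v = 1"
      by (auto simp: affine_hull_2)
    then have u: "u = 1 - v" by simp
    have "z = (1 - v / k) *\<^sub>R x\<^sub>0 + (v / k) *\<^sub>R y\<^sub>0"
      using z k l k0 \<open>k = l\<close> u by (simp add: algebra_simps)
    then show "z \<in> affine hull {x\<^sub>0, y\<^sub>0}"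
      unfolding affine_hull_2 by (intro CollectI exI conjI) (assumption, simp)
  qed
  then show "affine_parallel (affine hull {x\<^sub>1, y\<^sub>1}) (affine hull {x\<^sub>0, y\<^sub>0})"
    by (auto simp: affine_parallel_def)
qed

text \<open>Scale \<open>d\<close> and \<open>e\<close> to \<open>x\<close> and \<open>y\<close>
  such that the line through \<open>y\<close> along \<open>x\<close> and the line through
  \<open>x\<close> along \<open>y\<close> support \<open>K\<close>. They meet at the exterior corner
  \<open>x + y\<close>, and \<open>d\<close>, \<open>e\<close> take the places of
  \<open>x\<^sub>0\<close>, \<open>y\<^sub>0\<close>.\<close>

lemma constant_at_exterior_corner:
  assumes P: tangent_property and de: "d \<in> frontier K" "e \<in> frontier K" "\<omega> d e \<noteq> 0"
    and p: "(antinorm e / \<bar>\<omega> d e\<bar>) *\<^sub>R d + (antinorm d / \<bar>\<omega> d e\<bar>) *\<^sub>R e \<notin> K"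
  shows "antinorm d = antinorm e"
proof -
  define k where "k = antinorm e / \<bar>\<omega> d e\<bar>"
  define l where "l = antinorm d / \<bar>\<omega> d e\<bar>"
  have pos: "antinorm d > 0" "antinorm e > 0" using antinorm_pos frontier_nonzero de by auto
  have kl: "k > 0" "l > 0" using pos de by (auto simp: k_def l_def)
  define x y where "x = k *\<^sub>R d" and "y = l *\<^sub>R e"
  have xy: "\<omega> x y \<noteq> 0" "\<omega> y x \<noteq> 0" using kl de swap[of x y] by (auto simp: x_def y_def)
  have "antinorm d = l * \<bar>\<omega> d e\<bar>" "antinorm e = k * \<bar>\<omega> d e\<bar>"
    using de(3) by (simp_all add: k_def l_def)
  then have A: "antinorm x = \<bar>\<omega> x y\<bar>" "antinorm y = \<bar>\<omega> y x\<bar>"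
    using kl swap[of e d] by (simp_all add: x_def y_def antinorm_scale abs_mult)
  have "y \<in> {z. \<omega> x z = \<omega> x y}" "y \<notin> {z. \<omega> y z = \<omega> y x}" using xy by auto
  then have ne: "{z. \<omega> x z = \<omega> x y} \<noteq> {z. \<omega> y z = \<omega> y x}" by blast
  have par: "affine_parallel (affine hull {x, y}) (affine hull {d, e})"
  proof (rule P[unfolded tangent_property_def, rule_format, OF p, OF conjI, OF ne], intro conjI)
    show "supporting_line K {z. \<omega> x z = \<omega> x y}" "supporting_line K {z. \<omega> y z = \<omega> y x}"
      using supporting_line_form xy A by auto
    show "affine_parallel {z. \<omega> x z = \<omega> x y} {z. \<omega> x z = 0}"
      "affine_parallel {z. \<omega> y z = \<omega> y x} {z. \<omega> y z = 0}" by (rule affine_parallel_form)+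
    have "d = (1 / k) *\<^sub>R x" "e = (1 / l) *\<^sub>R y" using kl by (auto simp: x_def y_def)
    moreover have "1 / k \<ge> 0" "1 / l \<ge> 0" using kl by auto
    ultimately have "d \<in> ray_through x" "e \<in> ray_through y"
      unfolding ray_through_def by blast+
    then show "d \<in> {z. \<omega> x z = 0} \<inter> frontier K \<inter> ray_through x"
      "e \<in> {z. \<omega> y z = 0} \<inter> frontier K \<inter> ray_through y"
      using de by (auto simp: x_def y_def)
  qed (auto simp: x_def y_def k_def l_def)
  then obtain c where c: "affine hull {d, e} = (\<lambda>z. c + z) ` (affine hull {x, y})"
    unfolding affine_parallel_def by blast
  have "d \<in> (\<lambda>z. c + z) ` (affine hull {x, y})" "e \<in> (\<lambda>z. c + z) ` (affine hull {x, y})"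
    unfolding c[symmetric] by (auto intro: hull_inc)
  then obtain u v u' v' where uv: "d = c + (u *\<^sub>R x + v *\<^sub>R y)" "u + v = 1"
      "e = c + (u' *\<^sub>R x + v' *\<^sub>R y)" "u' + v' = 1"
    unfolding affine_hull_2 by blast
  \<comment> \<open>Parallelism makes \<open>d - e\<close> a multiple \<open>m\<close> of
    \<open>x - y\<close>. Pairing with \<open>e\<close> and with \<open>d\<close> isolates
    \<open>m * k = 1\<close> and \<open>m * l = 1\<close>.\<close>
  define m where "m = u - u'"
  have "d - e = (u - u') *\<^sub>R x + (v - v') *\<^sub>R y"
    by (subst uv(1), subst uv(3)) (simp add: algebra_simps)
  moreover have "v - v' = - m" using uv by (simp add: m_def)
  ultimately have eq: "d - e = m *\<^sub>R x - m *\<^sub>R y"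
    unfolding m_def[symmetric] by simp
  have "\<omega> (d - e) e = m * k * \<omega> d e" unfolding eq by (simp add: x_def y_def)
  moreover have "\<omega> d (d - e) = - (m * l * \<omega> d e)" unfolding eq by (simp add: x_def y_def)
  ultimately have "m * k = 1" "m * l = 1" using de(3) by simp_all
  then have "m * k = m * l" "m \<noteq> 0" by auto
  then have "k = l" by simp
  then show ?thesis using de(3) by (simp add: k_def l_def)
qed

text \<open>Parallel frontier points agree up to sign. Otherwise an exterior corner settles the
  claim, with \<open>- e\<close> in place of \<open>e\<close> for the second corner, or else both
  corners lie in \<open>K\<close>.\<close>

lemma constant_if_tangent_property:
  assumes P: tangent_property and de: "d \<in> frontier K" "e \<in> frontier K"
  shows "antinorm d = antinorm e"
proof (cases "\<omega> d e = 0")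
  case True
  have d: "d \<noteq> 0" using de frontier_nonzero by blast
  obtain u where u: "\<omega> d u \<noteq> 0" using d nondegenerate by blast
  define c where "c = \<omega> e u / \<omega> d u"
  have e: "e = c *\<^sub>R d" using decomposition[OF u, of e] True by (simp add: c_def)
  have "c \<noteq> 0" using e frontier_nonzero[OF de(2)] by auto
  have "\<bar>c\<bar> \<le> 1"
  proof -
    have "\<bar>c\<bar> *\<^sub>R d \<in> K"
      using frontier_mem[OF de(2)] uminus_mem[OF frontier_mem[OF de(2)]] e by (cases "c \<ge> 0") auto
    then show ?thesis using frontier_scale_le de by blast
  qed
  moreover have "\<bar>1 / c\<bar> \<le> 1"
  proof -
    have "(1 / c) *\<^sub>R e \<in> K" "(- (1 / c)) *\<^sub>R e \<in> K"
      using frontier_mem[OF de(1)] uminus_mem[OF frontier_mem[OF de(1)]] e \<open>c \<noteq> 0\<close> by auto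
    then show ?thesis using frontier_scale_le[OF de(2)] by (metis abs_le_iff)
  qed
  ultimately have "\<bar>c\<bar> = 1" using \<open>c \<noteq> 0\<close> by (simp add: divide_le_eq)
  then show ?thesis using e by (simp add: antinorm_scale)
next
  case False
  define k where "k = antinorm e / \<bar>\<omega> d e\<bar>"
  define l where "l = antinorm d / \<bar>\<omega> d e\<bar>"
  have neg_e: "- e \<in> frontier K"
    using de(2) frontier_image_uminus by blast
  consider "k *\<^sub>R d + l *\<^sub>R e \<notin> K" | "k *\<^sub>R d + l *\<^sub>R (- e) \<notin> K"
    | "k *\<^sub>R d + l *\<^sub>R e \<in> K" "k *\<^sub>R d - l *\<^sub>R e \<in> K" by auto
  then show ?thesis
  proof cases
    case 1
    then show ?thesis using constant_at_exterior_corner[OF P de False] by (simp add: k_def l_def)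
  next
    case 2
    then show ?thesis
      using constant_at_exterior_corner[OF P de(1) neg_e] False
      by (simp add: k_def l_def antinorm_uminus)
  next
    \<comment> \<open>Averaging one corner with the other, or with the reflection of the other, puts
      the side midpoints \<open>k d\<close> and \<open>l e\<close> into \<open>K\<close>. This
      bounds both antinorms by the absolute value of \<open>\<omega> d e\<close>, which is always a
      lower bound.\<close>
    case 3
    have "(1/2) *\<^sub>R (k *\<^sub>R d + l *\<^sub>R e) + (1/2) *\<^sub>R (k *\<^sub>R d - l *\<^sub>R e) \<in> K"
      using convexD[OF convex 3] by simp
    moreover have "(1/2) *\<^sub>R (k *\<^sub>R d + l *\<^sub>R e) + (1/2) *\<^sub>R (k *\<^sub>R d - l *\<^sub>R e) = k *\<^sub>R d"
      by (simp add: algebra_simps flip: scaleR_add_left)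
    ultimately have "k \<le> 1" using frontier_scale_le[OF de(1)] by simp
    have "(1/2) *\<^sub>R (k *\<^sub>R d + l *\<^sub>R e) + (1/2) *\<^sub>R (- (k *\<^sub>R d - l *\<^sub>R e)) \<in> K"
      using convexD[OF convex 3(1) uminus_mem[OF 3(2)]] by simp
    moreover have "(1/2) *\<^sub>R (k *\<^sub>R d + l *\<^sub>R e) + (1/2) *\<^sub>R (- (k *\<^sub>R d - l *\<^sub>R e)) = l *\<^sub>R e"
      by (simp add: algebra_simps flip: scaleR_add_left)
    ultimately have "l \<le> 1" using frontier_scale_le[OF de(2)] by simp
    have "antinorm e \<le> \<bar>\<omega> d e\<bar>" "antinorm d \<le> \<bar>\<omega> d e\<bar>"
      using \<open>k \<le> 1\<close> \<open>l \<le> 1\<close> False by (auto simp: k_def l_def divide_le_eq)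
    moreover have "\<bar>\<omega> d e\<bar> \<le> antinorm e" "\<bar>\<omega> d e\<bar> \<le> antinorm d"
      using antinorm_upper[OF frontier_mem[OF de(1)], of e]
        antinorm_upper[OF frontier_mem[OF de(2)], of d] swap[of d e] by simp_all
    ultimately show ?thesis by linarith
  qed
qed

section \<open>Radon curves\<close>

text \<open>By homogeneity each ray carries only one vector of antinorm 1, and its frontier point is
  such a vector.\<close>

lemma antinorm_eq_1_iff:
  assumes one: "\<And>u. u \<in> frontier K \<Longrightarrow> antinorm u = 1"
  shows "antinorm x = 1 \<longleftrightarrow> x \<in> frontier K"
proof
  assume x: "antinorm x = 1"
  then have "x \<noteq> 0" using antinorm_scale[of 0 0] by auto
  then obtain t where t: "t > 0" "t *\<^sub>R x \<in> frontier K" by (rule ray_frontier)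
  then have "t = 1" using one[OF t(2)] x by (simp add: antinorm_scale)
  then show "x \<in> frontier K" using t by simp
qed (rule one)

lemma radial_frontier:
  assumes one: "\<And>u. u \<in> frontier K \<Longrightarrow> antinorm u = 1" and "x \<noteq> 0"
  shows "x /\<^sub>R antinorm x \<in> frontier K"
  using antinorm_pos[OF \<open>x \<noteq> 0\<close>]
  by (simp add: antinorm_eq_1_iff[OF one, symmetric] antinorm_scale)

lemma antinorm_le_1:
  assumes one: "\<And>u. u \<in> frontier K \<Longrightarrow> antinorm u = 1" and x: "x \<in> K"
  shows "antinorm x \<le> 1"
proof (cases "x = 0")
  case True
  then show ?thesis using antinorm_scale[of 0 0] by simp
next
  case False
  have "antinorm x *\<^sub>R (x /\<^sub>R antinorm x) \<in> K" using x antinorm_pos[OF False] by simp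
  then show ?thesis using radial_frontier[OF one False] frontier_scale_le by blast
qed

text \<open>The strip is convex and \<open>K\<close> is the hull of its frontier, so testing there
  suffices. This lets the arcs of a Radon curve be estimated separately.\<close>

lemma antinorm_least_frontier:
  assumes "\<And>x. x \<in> frontier K \<Longrightarrow> \<bar>\<omega> x u\<bar> \<le> c"
  shows "antinorm u \<le> c"
proof (rule antinorm_least)
  have "convex ((\<lambda>x. \<omega> x u) -` {-c..c})"
    by (intro convex_linear_vimage linear_form) simp
  moreover have "frontier K \<subseteq> (\<lambda>x. \<omega> x u) -` {-c..c}"
    using assms by (auto simp: abs_le_iff minus_le_iff)
  ultimately have "K \<subseteq> (\<lambda>x. \<omega> x u) -` {-c..c}"
    using hull_minimal convex_hull_frontier by metis
  then show "\<bar>\<omega> x u\<bar> \<le> c" if "x \<in> K" for x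
    using that by (auto simp: abs_le_iff minus_le_iff)
qed

text \<open>Through \<open>\<omega>\<close>, the vector \<open>y\<close> represents a supporting
  functional of \<open>K\<close> at \<open>x\<close>, scaled to the value 1 at
  \<open>x\<close>.\<close>

lemma supporting_functional:
  assumes vw: "\<omega> v w = 1" and x: "x \<in> frontier K"
  obtains y where "\<omega> x y = 1" "antinorm y = 1"
proof -
  have "x \<in> K" "x \<notin> rel_interior K"
    using x zero_interior rel_interior_nonempty_interior[of K] by (auto simp: frontier_eq)
  then obtain a where a: "\<And>y. y \<in> K \<Longrightarrow> a \<bullet> x \<le> a \<bullet> y"
    "\<And>y. y \<in> rel_interior K \<Longrightarrow> a \<bullet> x < a \<bullet> y"
    using supporting_hyperplane_rel_boundary[OF convex, of x] by metis
  have ax: "a \<bullet> x < 0"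
    using a(2)[of 0] zero_interior interior_subset_rel_interior by fastforce
  \<comment> \<open>The coefficients come from testing
    \<open>\<omega> z y = (a \<bullet> z) / (a \<bullet> x)\<close> at \<open>v\<close> and
    \<open>w\<close>. As \<open>a \<bullet> x\<close> is negative, the division turns the minimum at
    \<open>x\<close> into a maximum.\<close>
  define y where "y = (1 / (a \<bullet> x)) *\<^sub>R ((a \<bullet> v) *\<^sub>R w - (a \<bullet> w) *\<^sub>R v)"
  have y: "\<omega> z y = (a \<bullet> z) / (a \<bullet> x)" for z
  proof -
    have "a \<bullet> z = a \<bullet> (\<omega> z w *\<^sub>R v + \<omega> v z *\<^sub>R w)" using unit_coords[OF vw, of z] by (rule arg_cong)
    then have num: "a \<bullet> z = (a \<bullet> v) * \<omega> z w - (a \<bullet> w) * \<omega> z v"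
      by (simp add: inner_add_right swap[of z v])
    show ?thesis
      unfolding num by (simp add: y_def)
  qed
  have le: "\<omega> z y \<le> 1" if "z \<in> K" for z
    using a(1)[OF that] ax unfolding y by (simp add: divide_le_eq)
  have "antinorm y \<le> 1"
    by (intro antinorm_least) (use le uminus_mem le[OF uminus_mem] in \<open>simp add: abs_le_iff\<close>)
  moreover have "\<omega> x y = 1" using ax by (simp add: y)
  moreover have "1 \<le> antinorm y"
    using antinorm_upper[OF \<open>x \<in> K\<close>, of y] \<open>\<omega> x y = 1\<close> by simp
  ultimately show ?thesis using that by simp
qed

text \<open>On \<open>C\<close> the value is 1 once the supremum over \<open>\<Gamma>\<close> is
  seen to equal that over \<open>K\<close>. On \<open>\<Gamma>\<close> it then follows by
  duality.\<close>

lemma antinorm_radon: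
  assumes vw: "\<omega> v w = 1" and hull: "\<Gamma> \<subseteq> convex hull {0, v, w, v + w}"
    and mem: "v \<in> \<Gamma>" "w \<in> \<Gamma>" and C: "C = conjugate_arc \<omega> v w \<Gamma> ` {0..1}"
    and fr: "frontier K = \<Gamma> \<union> C \<union> uminus ` \<Gamma> \<union> uminus ` C"
    and d: "d \<in> frontier K"
  shows "antinorm d = 1"
proof -
  have sub: "\<Gamma> \<subseteq> K" using fr frontier_mem by blast
  \<comment> \<open>In coordinates with respect to \<open>v\<close> and \<open>w\<close>, the hull
    is the unit square.\<close>
  have sq: "0 \<le> \<omega> x w" "\<omega> x w \<le> 1" "0 \<le> \<omega> v x" "\<omega> v x \<le> 1" if "x \<in> \<Gamma>" for x
  proof -
    have "convex ((\<lambda>x. \<omega> x w) -` {0..1} \<inter> (\<lambda>x. \<omega> v x) -` {0..1})"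
      by (intro convex_Int convex_linear_vimage linear_form) simp_all
    then have "convex hull {0, v, w, v + w} \<subseteq> (\<lambda>x. \<omega> x w) -` {0..1} \<inter> (\<lambda>x. \<omega> v x) -` {0..1}"
      by (intro hull_minimal) (auto simp: vw)
    then have "x \<in> (\<lambda>x. \<omega> x w) -` {0..1} \<inter> (\<lambda>x. \<omega> v x) -` {0..1}"
      using that hull by blast
    then show "0 \<le> \<omega> x w" "\<omega> x w \<le> 1" "0 \<le> \<omega> v x" "\<omega> v x \<le> 1" by auto
  qed
  define u where "u t = (1 - t) *\<^sub>R w + t *\<^sub>R (- v)" for t
  define s where "s t = (SUP x\<in>\<Gamma>. \<bar>\<omega> x (u t)\<bar>)" for t
  have cu: "\<omega> (u t) w = - t" "\<omega> v (u t) = 1 - t" "\<omega> w (u t) = t" for t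
    using swap[of w v] by (simp_all add: u_def vw)
  have s_upper: "\<bar>\<omega> x (u t)\<bar> \<le> s t" if "x \<in> \<Gamma>" for x t
    unfolding s_def
    by (rule cSUP_upper[OF that bdd_above_mono[OF antinorm_bdd]]) (use sub in auto)
  have s_ge: "t \<le> s t" "1 - t \<le> s t" for t
    using s_upper[OF mem(1), of t] s_upper[OF mem(2), of t] by (simp_all add: cu)
  have s_pos: "s t > 0" if "0 \<le> t" "t \<le> 1" for t
    using s_ge[of t] that by linarith
  have CE: "\<exists>t. 0 \<le> t \<and> t \<le> 1 \<and> y = u t /\<^sub>R s t" if "y \<in> C" for y
    using that unfolding C conjugate_arc_def Let_def u_def s_def by auto
  have CI: "u t /\<^sub>R s t \<in> C" if "0 \<le> t" "t \<le> 1" for t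
    using that unfolding C conjugate_arc_def Let_def u_def s_def by auto
  have anti_u: "antinorm (u t) = s t" if t: "0 \<le> t" "t \<le> 1" for t
  proof (rule antisym)
    \<comment> \<open>Points of \<open>C\<close> have coordinates \<open>- a\<close> and
      \<open>b\<close> with \<open>a\<close>, \<open>b\<close> in the unit interval. The pairing is
      thus a difference of nonnegative terms at most \<open>t\<close> and \<open>1 - t\<close>, both
      below \<open>s t\<close> because \<open>w\<close> and \<open>v\<close> lie in
      \<open>\<Gamma>\<close>.\<close>
    have *: "\<bar>\<omega> y (u t)\<bar> \<le> s t" if y: "y \<in> C" for y
    proof -
      obtain r where r: "0 \<le> r" "r \<le> 1" "y = u r /\<^sub>R s r" using CE[OF y] by blast
      define a b where "a = r / s r" and "b = (1 - r) / s r"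
      have ab: "0 \<le> a" "a \<le> 1" "0 \<le> b" "b \<le> 1"
        using r s_pos[of r] s_ge[of r] by (auto simp: a_def b_def)
      have yc: "\<omega> y w = - a" "\<omega> v y = b"
        unfolding r by (simp_all add: cu a_def b_def divide_inverse)
      have eq: "\<omega> y (u t) = b * t - a * (1 - t)"
        unfolding form_coords[OF vw, of y "u t"] yc cu by simp
      have "0 \<le> b * t" "b * t \<le> s t" "0 \<le> a * (1 - t)" "a * (1 - t) \<le> s t"
        using ab t s_ge[of t] mult_right_mono[of b 1 t] mult_right_mono[of a 1 "1 - t"] by simp_all
      then show ?thesis unfolding eq abs_le_iff by simp
    qed
    show "antinorm (u t) \<le> s t"
      by (rule antinorm_least_frontier) (use * s_upper in \<open>auto simp: fr\<close>)
    show "s t \<le> antinorm (u t)"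
      unfolding s_def using mem sub by (intro cSUP_least) (auto intro: antinorm_upper)
  qed
  have on_C: "antinorm y = 1" if y: "y \<in> C" for y
  proof -
    obtain r where r: "0 \<le> r" "r \<le> 1" "y = u r /\<^sub>R s r" using CE[OF y] by blast
    then show ?thesis using s_pos[of r] by (simp add: antinorm_scale anti_u)
  qed
  have on_\<Gamma>: "antinorm x = 1" if x: "x \<in> \<Gamma>" for x
  proof (rule antisym)
    have 1: "\<bar>\<omega> z x\<bar> \<le> 1" if z: "z \<in> \<Gamma>" for z
    proof -
      have "0 \<le> \<omega> z w * \<omega> v x" "\<omega> z w * \<omega> v x \<le> 1" "0 \<le> \<omega> v z * \<omega> x w" "\<omega> v z * \<omega> x w \<le> 1"
        using sq[OF x] sq[OF z] by (auto intro: mult_le_one)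
      then show ?thesis unfolding form_coords[OF vw, of z x] by linarith
    qed
    have 2: "\<bar>\<omega> z x\<bar> \<le> 1" if "z \<in> C" for z
      using antinorm_upper[of x z] on_C[OF that] x sub swap[of x z] by auto
    show "antinorm x \<le> 1"
      by (rule antinorm_least_frontier) (use 1 2 in \<open>auto simp: fr\<close>)
    have "x \<in> frontier K" using x fr by blast
    then obtain y where y: "\<omega> x y = 1" "antinorm y = 1" by (rule supporting_functional[OF vw])
    define p q where "p = \<omega> v y" and "q = \<omega> w y"
    have q: "\<omega> y w = - q" using swap[of w y] by (simp add: q_def)
    have xy: "\<omega> x w * p + \<omega> v x * q = 1"
      using y(1) unfolding form_coords[OF vw, of x y] q p_def[symmetric] by simp
    have "p \<le> 1" "q \<le> 1"
      using antinorm_upper[of v y] antinorm_upper[of w y] mem sub y by (auto simp: p_def q_def)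
    \<comment> \<open>If the normal direction \<open>y\<close> lies in the second quadrant, it is a point of \<open>C\<close>. Otherwise
      \<open>x\<close> is on the side of the unit square through \<open>w\<close> or \<open>v\<close>, so that \<open>v\<close> or \<open>w\<close>
      replaces \<open>y\<close>.\<close>
    consider "p < 0" | "q < 0" | "p \<ge> 0" "q \<ge> 0" by linarith
    then show "1 \<le> antinorm x"
    proof cases
      case 1
      then have "\<omega> x w * p \<le> 0" using sq[OF x] by (simp add: mult_nonneg_nonpos)
      moreover have "\<omega> v x * q \<le> \<omega> v x * 1" using \<open>q \<le> 1\<close> sq[OF x] by (intro mult_left_mono) auto
      ultimately have "1 \<le> \<bar>\<omega> v x\<bar>" using xy by linarith
      then show ?thesis using antinorm_upper[of v x] mem sub by force
    next
      case 2
      then have "\<omega> v x * q \<le> 0" using sq[OF x] by (simp add: mult_nonneg_nonpos)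
      moreover have "\<omega> x w * p \<le> \<omega> x w * 1" using \<open>p \<le> 1\<close> sq[OF x] by (intro mult_left_mono) auto
      ultimately have "1 \<le> \<bar>\<omega> w x\<bar>" using xy swap[of w x] by linarith
      then show ?thesis using antinorm_upper[of w x] mem sub by force
    next
      case 3
      define t where "t = q / (p + q)"
      have pq: "p + q > 0" using 3 xy by (cases "p = 0"; cases "q = 0") auto
      then have t: "0 \<le> t" "t \<le> 1" "1 - t = p / (p + q)"
        using 3 by (auto simp: t_def field_simps)
      have yc: "y = p *\<^sub>R w + q *\<^sub>R (- v)"
        using unit_coords[OF vw, of y] q by (simp add: p_def)
      have ut: "u t = (1 / (p + q)) *\<^sub>R y"
        unfolding u_def t(3) unfolding t_def by (subst yc) (simp add: algebra_simps)
      have "s t = 1 / (p + q)"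
        using anti_u[OF t(1,2)] pq y(2) by (simp add: ut antinorm_scale)
      then have "u t /\<^sub>R s t = y" using pq by (simp add: ut)
      then have "y \<in> K" using CI[OF t(1,2)] fr frontier_mem by blast
      then show ?thesis using antinorm_upper[of y x] y(1) swap[of x y] by simp
    qed
  qed
  show ?thesis using d on_C on_\<Gamma> unfolding fr by (auto simp: antinorm_uminus)
qed

text \<open>Otherwise \<open>v\<close> or \<open>w\<close> could be pushed outwards along its ray,
  increasing the form.\<close>

lemma maximizer_frontier:
  assumes "v \<in> K" "w \<in> K" and vw: "\<omega> v w = 1"
    and max: "\<And>x y. x \<in> K \<Longrightarrow> y \<in> K \<Longrightarrow> \<omega> x y \<le> 1"
  shows "v \<in> frontier K" "w \<in> frontier K"
proof -
  have "v \<noteq> 0" using vw by auto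
  then obtain t where t: "t > 0" "t *\<^sub>R v \<in> frontier K" by (rule ray_frontier)
  have "1 / t \<le> 1" by (rule frontier_scale_le[OF t(2)]) (use t assms in simp)
  moreover have "t \<le> 1" using max[OF frontier_mem[OF t(2)] assms(2)] vw by simp
  ultimately have "t = 1" using t by simp
  then show "v \<in> frontier K" using t by simp
  have "w \<noteq> 0" using vw by auto
  then obtain t where t: "t > 0" "t *\<^sub>R w \<in> frontier K" by (rule ray_frontier)
  have "1 / t \<le> 1" by (rule frontier_scale_le[OF t(2)]) (use t assms in simp)
  moreover have "t \<le> 1" using max[OF assms(1) frontier_mem[OF t(2)]] vw by simp
  ultimately have "t = 1" using t by simp
  then show "w \<in> frontier K" using t by simp
qed

text \<open>Compactness of \<open>K \<times> K\<close> gives the pair; the maximum is positive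
  because the antinorm is positive at some point of \<open>K\<close>.\<close>

lemma exists_maximizer:
  obtains v w where "v \<in> K" "w \<in> K" "\<omega> v w > 0"
    "\<And>x y. x \<in> K \<Longrightarrow> y \<in> K \<Longrightarrow> \<omega> x y \<le> \<omega> v w"
proof -
  have "\<exists>p\<in>K \<times> K. \<forall>q\<in>K \<times> K. \<omega> (fst q) (snd q) \<le> \<omega> (fst p) (snd p)"
    using zero_mem by (intro continuous_attains_sup compact_Times compact continuous_intros) auto
  then obtain v w where vw: "v \<in> K" "w \<in> K" "\<And>x y. x \<in> K \<Longrightarrow> y \<in> K \<Longrightarrow> \<omega> x y \<le> \<omega> v w"
    by auto
  obtain b :: 'a where "b \<in> Basis" using nonempty_Basis by blast
  then have "b \<noteq> 0" by (rule nonzero_Basis)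
  then obtain t where t: "t > 0" "t *\<^sub>R b \<in> frontier K" by (rule ray_frontier)
  then have "0 < antinorm (t *\<^sub>R b)" by (intro antinorm_pos frontier_nonzero)
  moreover obtain x where "x \<in> K" "\<omega> x (t *\<^sub>R b) = antinorm (t *\<^sub>R b)" by (rule antinorm_attained)
  ultimately have "0 < \<omega> v w" using vw(3)[of x "t *\<^sub>R b"] frontier_mem[OF t(2)] by simp
  then show ?thesis using that vw by blast
qed

end

section \<open>Building a Radon curve from an antinorm equal to 1 on the frontier\<close>

locale normalized_body = symmetric_body \<omega> K
  for \<omega> :: "'a::euclidean_space \<Rightarrow> 'a \<Rightarrow> real" and K +
  fixes v w :: 'a
  assumes one: "\<And>u. u \<in> frontier K \<Longrightarrow> antinorm u = 1"
    and v: "v \<in> frontier K" and w: "w \<in> frontier K" and vw: "\<omega> v w = 1"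
begin

lemmas coords = unit_coords[OF vw]

lemma wv: "\<omega> w v = - 1"
  using swap[of w v] vw by simp

lemma coords_le:
  assumes "z \<in> K"
  shows "\<bar>\<omega> z w\<bar> \<le> 1" "\<bar>\<omega> v z\<bar> \<le> 1"
  using antinorm_upper[OF assms, of w] antinorm_upper[OF assms, of v] one[OF v] one[OF w]
    swap[of v z] by simp_all

text \<open>By \<open>coords\<close>, the closed cone spanned by \<open>v\<close> and
  \<open>w\<close>.\<close>

definition quadrant :: "'a set" where
  "quadrant = {z. \<omega> z w \<ge> 0 \<and> \<omega> v z \<ge> 0}"

definition quarter :: "'a set" where
  "quarter = frontier K \<inter> quadrant"

lemma vw_quarter: "v \<in> quarter" "w \<in> quarter"
  using v w vw by (auto simp: quarter_def quadrant_def)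

text \<open>The arc is the radial projection to the frontier of the segment from \<open>v\<close> to
  \<open>w\<close>.\<close>

lemma quarter_connecting: "curve_connecting v w quarter"
proof -
  define u where "u t = (1 - t) *\<^sub>R v + t *\<^sub>R w" for t
  define g where "g t = u t /\<^sub>R antinorm (u t)" for t
  have cu: "\<omega> (u t) w = 1 - t" "\<omega> v (u t) = t" for t
    by (simp_all add: u_def vw)
  have u0: "u t \<noteq> 0" for t
    using cu[of t] by (metis bilinear_rules(9,10) diff_zero zero_neq_one)
  have A: "antinorm (u t) > 0" for t by (rule antinorm_pos[OF u0])
  have cont: "continuous_on {0..1} g"
    unfolding g_def u_def[abs_def]
    by (intro continuous_intros continuous_on_compose2[OF antinorm_continuous])
      (use A in \<open>auto simp: u_def less_le\<close>)
  have inj: "inj_on g {0..1}"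
  proof (rule inj_onI)
    fix s t assume "g s = g t"
    then have *: "\<omega> (g s) w = \<omega> (g t) w" "\<omega> v (g s) = \<omega> v (g t)" by auto
    have 1: "(1 - s) / antinorm (u s) = (1 - t) / antinorm (u t)"
      using *(1) by (simp add: g_def cu field_simps)
    have 2: "s / antinorm (u s) = t / antinorm (u t)"
      using *(2) by (simp add: g_def cu field_simps)
    \<comment> \<open>The coordinates of \<open>g s\<close> add up to this number, so equal points
      have equal scaling factors and hence equal parameters.\<close>
    have "1 / antinorm (u s) = (1 - s) / antinorm (u s) + s / antinorm (u s)"
      by (simp add: diff_divide_distrib)
    also have "\<dots> = 1 / antinorm (u t)"
      unfolding 1 2 by (simp add: diff_divide_distrib)
    finally show "s = t" using 2 A[of s] A[of t] by simp
  qed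
  have "g ` {0..1} = quarter"
  proof (intro equalityI subsetI)
    fix z assume "z \<in> g ` {0..1}"
    then obtain t where t: "0 \<le> t" "t \<le> 1" "z = g t" by auto
    have "z \<in> frontier K" unfolding t g_def by (rule radial_frontier[OF one u0])
    then show "z \<in> quarter"
      using t A[of t] by (simp add: quarter_def quadrant_def g_def cu)
  next
    fix z assume z: "z \<in> quarter"
    define a b where "a = \<omega> z w" and "b = \<omega> v z"
    have ab: "a \<ge> 0" "b \<ge> 0" using z by (auto simp: quarter_def quadrant_def a_def b_def)
    have z1: "antinorm z = 1" "z \<noteq> 0"
      using z one frontier_nonzero by (auto simp: quarter_def)
    then have "a + b \<noteq> 0" using ab coords[of z] by (auto simp: a_def b_def add_nonneg_eq_0_iff)
    then have s: "a + b > 0" using ab by simp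
    have zc: "z = a *\<^sub>R v + b *\<^sub>R w" using coords[of z] by (simp add: a_def b_def)
    \<comment> \<open>At the parameter \<open>b / (a + b)\<close> the segment from \<open>v\<close>
      to \<open>w\<close> crosses the ray through \<open>z\<close>.\<close>
    have e: "1 - b / (a + b) = a / (a + b)" using s by (simp add: field_simps)
    have uz: "u (b / (a + b)) = (1 / (a + b)) *\<^sub>R z"
      unfolding u_def e by (simp add: zc scaleR_add_right)
    have "g (b / (a + b)) = z"
      unfolding g_def uz antinorm_scale z1 using s by simp
    then show "z \<in> g ` {0..1}" using ab s
      by (intro image_eqI[where x = "b / (a + b)"]) auto
  qed
  moreover have "g 0 = v" "g 1 = w"
    using one[OF v] one[OF w] by (auto simp: g_def u_def)
  ultimately show ?thesis
    using cont inj unfolding curve_connecting_def arc_def path_def pathstart_def pathfinish_def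
      path_image_def by blast
qed

text \<open>By \<open>coords_le\<close> the coordinates lie in the unit interval; interpolating
  first along \<open>v\<close>, then along \<open>w\<close>, combines the four corners.\<close>

lemma quarter_subset: "quarter \<subseteq> convex hull {0, v, w, v + w}"
proof
  fix z assume z: "z \<in> quarter"
  define a b where "a = \<omega> z w" and "b = \<omega> v z"
  have ab: "0 \<le> a" "a \<le> 1" "0 \<le> b" "b \<le> 1"
    using z coords_le[of z] frontier_mem by (auto simp: quarter_def quadrant_def a_def b_def)
  let ?H = "convex hull {0, v, w, v + w}"
  have H: "0 \<in> ?H" "v \<in> ?H" "w \<in> ?H" "v + w \<in> ?H" by (auto intro: hull_inc)
  have C: "convex ?H" by (rule convex_convex_hull)
  have "(1 - a) *\<^sub>R 0 + a *\<^sub>R v \<in> ?H" "(1 - a) *\<^sub>R w + a *\<^sub>R (v + w) \<in> ?H"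
    by (rule convexD[OF C]; use ab H in simp)+
  then have "(1 - b) *\<^sub>R ((1 - a) *\<^sub>R 0 + a *\<^sub>R v) + b *\<^sub>R ((1 - a) *\<^sub>R w + a *\<^sub>R (v + w)) \<in> ?H"
    by (rule convexD[OF C]) (use ab in simp_all)
  moreover have "(1 - b) *\<^sub>R ((1 - a) *\<^sub>R 0 + a *\<^sub>R v) + b *\<^sub>R ((1 - a) *\<^sub>R w + a *\<^sub>R (v + w)) = a *\<^sub>R v + b *\<^sub>R w"
    by (simp add: algebra_simps)
  ultimately show "z \<in> ?H" using coords[of z] by (simp add: a_def b_def)
qed

lemma halfplane_left:
  "closed {z. \<omega> z y \<ge> 0}" "convex {z. \<omega> z y \<ge> 0}"
  "\<omega> x y \<noteq> 0 \<Longrightarrow> interior {z. \<omega> z y \<ge> 0} = {z. \<omega> z y > 0}"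
proof -
  obtain a where a: "\<And>z. \<omega> z y = a \<bullet> z" using form_as_inner by blast
  show "closed {z. \<omega> z y \<ge> 0}" "convex {z. \<omega> z y \<ge> 0}"
    unfolding a using closed_halfspace_ge[of 0 a] convex_halfspace_ge[of 0 a] by simp_all
  assume "\<omega> x y \<noteq> 0"
  then have "a \<noteq> 0" by (auto simp: a)
  then show "interior {z. \<omega> z y \<ge> 0} = {z. \<omega> z y > 0}"
    unfolding a using interior_halfspace_ge[of a 0] by simp
qed

lemma quadrant_eq: "quadrant = {z. \<omega> z w \<ge> 0} \<inter> {z. \<omega> z (- v) \<ge> 0}"
  using swap[of v] by (auto simp: quadrant_def)

lemma interior_quadrant: "interior quadrant = {z. \<omega> z w > 0 \<and> \<omega> v z > 0}"
proof -
  have "interior quadrant = {z. \<omega> z w > 0} \<inter> {z. \<omega> z (- v) > 0}"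
    unfolding quadrant_eq interior_Int
    using halfplane_left(3)[of v w] halfplane_left(3)[of w "- v"] vw wv by simp
  then show ?thesis using swap[of v] by auto
qed

lemma quadrant_body: "convex_body (K \<inter> quadrant)"
  unfolding convex_body_def
proof (intro conjI)
  have "closed quadrant" "convex quadrant"
    unfolding quadrant_eq by (intro closed_Int convex_Int halfplane_left)+
  then show "compact (K \<inter> quadrant)" "convex (K \<inter> quadrant)"
    using compact convex by (auto intro: compact_Int_closed convex_Int)
  \<comment> \<open>The point halfway to the frontier along \<open>v + w\<close> is interior to both
    sets.\<close>
  have "v + w \<noteq> 0" using vw wv by (metis bilinear_rules(1,9) self_zero add_0 add.right_neutral zero_neq_one)
  then obtain t where t: "t > 0" "t *\<^sub>R (v + w) \<in> frontier K" by (rule ray_frontier)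
  have "(1/2) *\<^sub>R (t *\<^sub>R (v + w)) \<in> interior K"
    by (intro shrink_interior frontier_mem t) auto
  moreover have "(1/2) *\<^sub>R (t *\<^sub>R (v + w)) \<in> interior quadrant"
    using t vw by (simp add: interior_quadrant)
  ultimately show "interior (K \<inter> quadrant) \<noteq> {}" by (auto simp: interior_Int)
qed

text \<open>A boundary point of the intersection lies on \<open>frontier K\<close> or has a
  vanishing coordinate; in the latter case \<open>coords_le\<close> keeps it on one of the
  segments.\<close>

lemma quadrant_frontier:
  "quarter \<union> closed_segment 0 v \<union> closed_segment 0 w = frontier (K \<inter> quadrant)"
proof -
  have "closed (K \<inter> quadrant)" using quadrant_body compact_imp_closed by (auto simp: convex_body_def)
  then have fr: "frontier (K \<inter> quadrant) = K \<inter> quadrant - interior K \<inter> interior quadrant"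
    by (simp add: frontier_def interior_Int)
  have seg: "z \<in> closed_segment 0 x \<longleftrightarrow> (\<exists>t. 0 \<le> t \<and> t \<le> 1 \<and> z = t *\<^sub>R x)" for z x :: 'a
    by (auto simp: in_segment)
  show ?thesis
  proof (intro equalityI subsetI)
    fix z assume "z \<in> quarter \<union> closed_segment 0 v \<union> closed_segment 0 w"
    then consider "z \<in> quarter" | t where "0 \<le> t" "t \<le> 1" "z = t *\<^sub>R v"
      | t where "0 \<le> t" "t \<le> 1" "z = t *\<^sub>R w" by (auto simp: seg)
    then show "z \<in> frontier (K \<inter> quadrant)"
    proof cases
      case 1
      then show ?thesis using frontier_mem by (auto simp: fr quarter_def frontier_eq)
    next
      case 2
      have "t *\<^sub>R v + (1 - t) *\<^sub>R 0 \<in> K"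
        using 2 by (intro convexD[OF convex]) (auto simp: frontier_mem v zero_mem)
      then have "z \<in> K \<inter> quadrant" "z \<notin> interior quadrant"
        using 2 vw unfolding interior_quadrant by (auto simp: quadrant_def)
      then show ?thesis unfolding fr by blast
    next
      case 3
      have "t *\<^sub>R w + (1 - t) *\<^sub>R 0 \<in> K"
        using 3 by (intro convexD[OF convex]) (auto simp: frontier_mem w zero_mem)
      then have "z \<in> K \<inter> quadrant" "z \<notin> interior quadrant"
        using 3 vw unfolding interior_quadrant by (auto simp: quadrant_def)
      then show ?thesis unfolding fr by blast
    qed
  next
    fix z assume z: "z \<in> frontier (K \<inter> quadrant)"
    then have zK: "z \<in> K" "\<omega> z w \<ge> 0" "\<omega> v z \<ge> 0"
      unfolding fr by (auto simp: quadrant_def)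
    from z consider "z \<in> frontier K" | "\<omega> z w = 0" | "\<omega> v z = 0"
      using zK unfolding fr frontier_eq interior_quadrant by fastforce
    then show "z \<in> quarter \<union> closed_segment 0 v \<union> closed_segment 0 w"
    proof cases
      case 1
      then show ?thesis using zK by (auto simp: quarter_def quadrant_def)
    next
      case 2
      then have "z = \<omega> v z *\<^sub>R w" using coords[of z] by simp
      then have "z \<in> closed_segment 0 w" unfolding seg using zK coords_le[OF zK(1)] by auto
      then show ?thesis by blast
    next
      case 3
      then have "z = \<omega> z w *\<^sub>R v" using coords[of z] by simp
      then have "z \<in> closed_segment 0 v" unfolding seg using zK coords_le[OF zK(1)] by auto
      then show ?thesis by blast
    qed
  qed
qed

text \<open>A maximizer over \<open>K\<close> with a negative coordinate does no better than
  \<open>w\<close> or \<open>v\<close>; one in the quadrant can be pushed out radially to the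
  frontier. So restricting to the quarter arc loses nothing.\<close>

lemma SUP_quarter:
  assumes t: "0 \<le> t" "t \<le> 1"
  defines "u \<equiv> (1 - t) *\<^sub>R w + t *\<^sub>R (- v)"
  shows "(SUP x\<in>quarter. \<bar>\<omega> x u\<bar>) = antinorm u"
proof (rule antisym)
  have sub: "quarter \<subseteq> K" using frontier_mem by (auto simp: quarter_def)
  show "(SUP x\<in>quarter. \<bar>\<omega> x u\<bar>) \<le> antinorm u"
    using vw_quarter sub by (intro cSUP_least) (auto intro: antinorm_upper)
  have bdd: "bdd_above ((\<lambda>x. \<bar>\<omega> x u\<bar>) ` quarter)"
    by (rule bdd_above_mono[OF antinorm_bdd]) (use sub in auto)
  have xu: "\<omega> x u = \<omega> x w * (1 - t) + \<omega> v x * t" for x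
    by (simp add: u_def swap[of v x] algebra_simps)
  obtain x where x: "x \<in> K" "\<omega> x u = antinorm u" by (rule antinorm_attained)
  have "\<exists>y\<in>quarter. antinorm u \<le> \<bar>\<omega> y u\<bar>"
  proof -
    consider "\<omega> x w < 0" | "\<omega> v x < 0" | "\<omega> x w \<ge> 0" "\<omega> v x \<ge> 0" by linarith
    then show ?thesis
    proof cases
      case 1
      have "\<omega> x w * (1 - t) \<le> 0" using 1 t by (simp add: mult_nonpos_nonneg)
      moreover have "\<omega> v x * t \<le> 1 * t" using t coords_le(2)[OF x(1)] by (intro mult_right_mono) auto
      ultimately have "antinorm u \<le> t" using x(2) xu[of x] by simp
      also have "t \<le> \<bar>\<omega> w u\<bar>" using xu[of w] vw by simp
      finally show ?thesis using vw_quarter by blast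
    next
      case 2
      have "\<omega> v x * t \<le> 0" using 2 t by (simp add: mult_nonpos_nonneg)
      moreover have "\<omega> x w * (1 - t) \<le> 1 * (1 - t)"
        using t coords_le(1)[OF x(1)] by (intro mult_right_mono) auto
      ultimately have "antinorm u \<le> 1 - t" using x(2) xu[of x] by simp
      also have "1 - t \<le> \<bar>\<omega> v u\<bar>" using xu[of v] vw by simp
      finally show ?thesis using vw_quarter by blast
    next
      case 3
      have "u \<noteq> 0"
      proof
        assume "u = 0"
        then have "\<omega> v u = 0" "\<omega> w u = 0" by simp_all
        then show False using xu[of v] xu[of w] vw by simp
      qed
      then have Au: "antinorm u > 0" by (rule antinorm_pos)
      then have x0: "x \<noteq> 0" using x by auto
      have Ax: "antinorm x > 0" "antinorm x \<le> 1"
        using antinorm_pos[OF x0] antinorm_le_1[OF one x(1)] by auto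
      have "x /\<^sub>R antinorm x \<in> quarter"
        using radial_frontier[OF one x0] 3 Ax by (simp add: quarter_def quadrant_def)
      moreover have "antinorm u \<le> \<bar>\<omega> (x /\<^sub>R antinorm x) u\<bar>"
        using Ax Au x(2) by (simp add: abs_mult field_simps)
      ultimately show ?thesis by blast
    qed
  qed
  then show "antinorm u \<le> (SUP x\<in>quarter. \<bar>\<omega> x u\<bar>)"
    using cSUP_upper2[OF bdd] by blast
qed

text \<open>By \<open>SUP_quarter\<close>, the conjugate arc is the radial projection to the
  frontier of the segment from \<open>w\<close> to \<open>- v\<close>.\<close>

lemma conjugate_quarter:
  "conjugate_arc \<omega> v w quarter ` {0..1} = {z \<in> frontier K. \<omega> z w \<le> 0 \<and> \<omega> v z \<ge> 0}"
proof -
  define u where "u t = (1 - t) *\<^sub>R w + t *\<^sub>R (- v)" for t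
  have arc: "conjugate_arc \<omega> v w quarter t = u t /\<^sub>R antinorm (u t)" if "t \<in> {0..1}" for t
    using that SUP_quarter[of t] unfolding conjugate_arc_def u_def Let_def by simp
  have cu: "\<omega> (u t) w = - t" "\<omega> v (u t) = 1 - t" for t
    by (simp_all add: u_def vw)
  have u0: "u t \<noteq> 0" for t
    using cu[of t] by (metis bilinear_rules(9,10) diff_zero neg_equal_0_iff_equal zero_neq_one)
  have A: "antinorm (u t) > 0" for t by (rule antinorm_pos[OF u0])
  show ?thesis
  proof (intro equalityI subsetI)
    fix z assume "z \<in> conjugate_arc \<omega> v w quarter ` {0..1}"
    then obtain t where t: "0 \<le> t" "t \<le> 1" "z = u t /\<^sub>R antinorm (u t)" using arc by auto
    have "z \<in> frontier K" unfolding t by (rule radial_frontier[OF one u0])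
    then show "z \<in> {z \<in> frontier K. \<omega> z w \<le> 0 \<and> \<omega> v z \<ge> 0}"
      using t A[of t] by (simp add: cu)
  next
    fix z assume z: "z \<in> {z \<in> frontier K. \<omega> z w \<le> 0 \<and> \<omega> v z \<ge> 0}"
    define a b where "a = - \<omega> z w" and "b = \<omega> v z"
    have ab: "a \<ge> 0" "b \<ge> 0" using z by (auto simp: a_def b_def)
    have z1: "antinorm z = 1" "z \<noteq> 0" using z one frontier_nonzero by auto
    then have "a + b \<noteq> 0" using ab coords[of z] by (auto simp: a_def b_def add_nonneg_eq_0_iff)
    then have s: "a + b > 0" using ab by simp
    have zc: "z = b *\<^sub>R w + a *\<^sub>R (- v)"
      using coords[of z] by (simp add: a_def b_def add.commute)
    have e: "1 - a / (a + b) = b / (a + b)" using s by (simp add: field_simps)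
    have uz: "u (a / (a + b)) = (1 / (a + b)) *\<^sub>R z"
      unfolding u_def e by (subst zc) (simp add: algebra_simps)
    have mem: "a / (a + b) \<in> {0..1}" using ab s by simp
    have "conjugate_arc \<omega> v w quarter (a / (a + b)) = z"
      unfolding arc[OF mem] uz antinorm_scale z1 using s by simp
    then show "z \<in> conjugate_arc \<omega> v w quarter ` {0..1}" using mem by blast
  qed
qed

text \<open>The signs of the two coordinates sort the frontier into the quarter, its conjugate arc
  and their reflections.\<close>

lemma radon: "radon_curve (frontier K)"
proof -
  let ?Q2 = "{z \<in> frontier K. \<omega> z w \<le> 0 \<and> \<omega> v z \<ge> 0}"
  have "frontier K = quarter \<union> ?Q2 \<union> uminus ` quarter \<union> uminus ` ?Q2"
  proof (intro equalityI subsetI)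
    fix z assume z: "z \<in> frontier K"
    then have mz: "- z \<in> frontier K" using frontier_image_uminus by blast
    have z': "z = - (- z)" by simp
    consider "z \<in> quarter" | "z \<in> ?Q2" | "- z \<in> quarter" | "- z \<in> ?Q2"
      using z mz by (auto simp: quarter_def quadrant_def) linarith
    then show "z \<in> quarter \<union> ?Q2 \<union> uminus ` quarter \<union> uminus ` ?Q2"
      by cases (use z' in blast)+
  next
    fix z assume "z \<in> quarter \<union> ?Q2 \<union> uminus ` quarter \<union> uminus ` ?Q2"
    then show "z \<in> frontier K" using frontier_image_uminus by (auto simp: quarter_def)
  qed
  then show ?thesis
    unfolding radon_curve_def conjugate_quarter[symmetric]
    using independent_pair[of v w] vw symplectic quarter_connecting quarter_subset quadrant_body
      quadrant_frontier
    by (intro exI[of _ v] exI[of _ w] exI[of _ \<omega>] exI[of _ quarter]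
        exI[of _ "conjugate_arc \<omega> v w quarter ` {0..1}"]) auto
qed

end

theorem proposition5p2:
  fixes \<gamma> :: "'a::euclidean_space set"
  assumes "DIM('a) = 2"
    and "closed_curve \<gamma>"
    and "\<exists>K. convex_body K \<and> \<gamma> = frontier K"
    and "\<gamma> = uminus ` \<gamma>"
  shows "radon_curve \<gamma> \<longleftrightarrow>
    (\<forall>p. p \<notin> convex hull \<gamma> \<longrightarrow>
      (\<forall>r s r\<^sub>o s\<^sub>o x\<^sub>1 x\<^sub>0 y\<^sub>1 y\<^sub>0.
        r \<noteq> s \<and>
        supporting_line (convex hull \<gamma>) r \<and> p \<in> r \<and>
        supporting_line (convex hull \<gamma>) s \<and> p \<in> s \<and>
        affine_parallel r r\<^sub>o \<and> 0 \<in> r\<^sub>o \<and>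
        x\<^sub>1 \<in> r\<^sub>o \<inter> s \<and> x\<^sub>0 \<in> r\<^sub>o \<inter> \<gamma> \<inter> ray_through x\<^sub>1 \<and>
        affine_parallel s s\<^sub>o \<and> 0 \<in> s\<^sub>o \<and>
        y\<^sub>1 \<in> s\<^sub>o \<inter> r \<and> y\<^sub>0 \<in> s\<^sub>o \<inter> \<gamma> \<inter> ray_through y\<^sub>1 \<longrightarrow>
        affine_parallel (affine hull {x\<^sub>1, y\<^sub>1}) (affine hull {x\<^sub>0, y\<^sub>0})))"
proof -
  obtain K where body: "convex_body K" and fr: "\<gamma> = frontier K" using assms(3) by blast
  have hull: "convex hull \<gamma> = K"
    using body Krein_Milman_frontier[of K] by (simp add: convex_body_def fr)
  have minus: "- x \<in> K" if "x \<in> K" for x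
  proof -
    have "uminus ` K = convex hull (uminus ` \<gamma>)"
      unfolding hull[symmetric] by (rule convex_hull_linear_image) (simp add: linear_iff)
    also have "\<dots> = K" using assms(4) hull by simp
    finally show ?thesis using that by blast
  qed
  have body': "symmetric_body \<omega> K" if "symplectic_form \<omega>" for \<omega>
    using assms(1) that body minus by unfold_locales auto
  obtain \<omega>\<^sub>0 :: "'a \<Rightarrow> 'a \<Rightarrow> real" where \<omega>0: "symplectic_form \<omega>\<^sub>0"
    using exists_symplectic_form[OF assms(1)] by blast
  \<comment> \<open>This form is for the converse direction; a Radon curve brings a form of its
    own.\<close>
  interpret B0: symmetric_body \<omega>\<^sub>0 K using \<omega>0 by (rule body')
  have "radon_curve (frontier K) \<longleftrightarrow> B0.tangent_property"
  proof
    assume "radon_curve (frontier K)"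
    then obtain v w \<omega> \<gamma>\<^sub>1 \<gamma>\<^sub>2 where R: "symplectic_form \<omega>" "\<omega> v w = 1"
      "curve_connecting v w \<gamma>\<^sub>1" "\<gamma>\<^sub>1 \<subseteq> convex hull {0, v, w, v + w}"
      "\<gamma>\<^sub>2 = conjugate_arc \<omega> v w \<gamma>\<^sub>1 ` {0..1}"
      "frontier K = \<gamma>\<^sub>1 \<union> \<gamma>\<^sub>2 \<union> uminus ` \<gamma>\<^sub>1 \<union> uminus ` \<gamma>\<^sub>2"
      unfolding radon_curve_def by (elim exE conjE) (rule that; assumption)
    interpret symmetric_body \<omega> K using R(1) by (rule body')
    have "v \<in> \<gamma>\<^sub>1" "w \<in> \<gamma>\<^sub>1"
      using R(3) unfolding curve_connecting_def
      by (metis pathstart_in_path_image, metis pathfinish_in_path_image)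
    then have "antinorm d = 1" if "d \<in> frontier K" for d
      using antinorm_radon[OF R(2,4) _ _ R(5,6) that] by blast
    then show B0.tangent_property using tangent_property_if_constant by simp
  next
    assume P: B0.tangent_property
    obtain v w where vw: "v \<in> K" "w \<in> K" "\<omega>\<^sub>0 v w > 0"
      "\<And>x y. x \<in> K \<Longrightarrow> y \<in> K \<Longrightarrow> \<omega>\<^sub>0 x y \<le> \<omega>\<^sub>0 v w" by (rule B0.exists_maximizer) blast
    \<comment> \<open>Rescaling makes the maximum over \<open>K \<times> K\<close> equal to 1, since
      \<open>radon_curve\<close> asks for \<open>\<omega> v w = 1\<close>.\<close>
    define \<omega> where "\<omega> x y = \<omega>\<^sub>0 x y / \<omega>\<^sub>0 v w" for x y
    have "bilinear \<omega>"
      unfolding bilinear_def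
      by (intro conjI allI linearI) (simp_all add: \<omega>_def add_divide_distrib)
    moreover have "x = 0" if "\<forall>y. \<omega> x y = 0" for x
      using that vw(3) B0.nondegenerate[of x] by (auto simp: \<omega>_def)
    ultimately have "symplectic_form \<omega>"
      by (simp add: symplectic_form_def) (simp add: \<omega>_def)
    then interpret symmetric_body \<omega> K by (rule body')
    have 1: "\<omega> v w = 1" using vw(3) by (simp add: \<omega>_def)
    have max: "\<omega> x y \<le> 1" if "x \<in> K" "y \<in> K" for x y
      using vw(3) vw(4)[OF that] by (simp add: \<omega>_def)
    note f = maximizer_frontier[OF vw(1,2) 1 max]
    \<comment> \<open>The tangent property makes the antinorm constant on the frontier; the
      maximizing pair identifies the constant as 1.\<close>
    have "antinorm w = 1"
    proof (rule antisym)
      show "antinorm w \<le> 1"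
        by (metis antinorm_attained max vw(2))
      show "1 \<le> antinorm w" using antinorm_upper[OF vw(1), of w] 1 by simp
    qed
    then have one: "antinorm u = 1" if "u \<in> frontier K" for u
      using constant_if_tangent_property[OF P that f(2)] by simp
    interpret normalized_body \<omega> K v w using one f 1 by unfold_locales
    show "radon_curve (frontier K)" by (rule radon)
  qed
  then show ?thesis
    unfolding B0.tangent_property_def hull fr[symmetric] .
qed

end
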